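(* Let $C\subset\mathbb{R}^n$ be a nonempty closed semi-algebraic set and let $\nu$ be a semi-algebraic norm on $\mathbb{R}^n$. Then the function $f(\cdot):=\mathrm{dist}_\nu(\cdot,C)$ is semi-algebraic.
   Context: $\mathrm{dist}_\nu(\mathbf{x},C):=\min\{\nu(\mathbf{x}-\mathbf{y}):\mathbf{y}\in C\}$. A set $S\subset\mathbb{R}^n$ is semi-algebraic if it is a finite union of sets each given by finitely many polynomial equalities $p_i(\mathbf{x})=0$ and polynomial inequalities $q_j(\mathbf{x})>0$. A function $f:\mathbb{R}^n\to\mathbb{R}$ is semi-algebraic if its graph $\{(\mathbf{x},f(\mathbf{x})):\mathbf{x}\in\mathbb{R}^n\}$ is a semi-algebraic set; a norm is semi-algebraic if it is so as a function. *)

theory Defs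
  imports "HOL-Analysis.Analysis"
begin

text \<open>
  Polynomials are rendered as \<^const>\<open>real_polynomial_function\<close>: the closure of the bounded
  linear functionals and the constants under addition and multiplication, which on a
  finite-dimensional space are the polynomial functions in the coordinates. The definitions are
  stated for an arbitrary Euclidean space so that they cover both subsets of R^n, as
  \<^typ>\<open>real ^ 'n\<close>, and graphs in R^(n+1), as \<^typ>\<open>(real ^ 'n) \<times> real\<close>.
\<close>

definition basic_semialgebraic :: "'a::euclidean_space set \<Rightarrow> bool" where
  "basic_semialgebraic S \<longleftrightarrow>
     (\<exists>P Q. finite P \<and> finite Q \<and>
        (\<forall>p\<in>P. real_polynomial_function p) \<and> (\<forall>q\<in>Q. real_polynomial_function q) \<and>
        S = {x. (\<forall>p\<in>P. p x = 0) \<and> (\<forall>q\<in>Q. q x > 0)})"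

definition semialgebraic :: "'a::euclidean_space set \<Rightarrow> bool" where
  "semialgebraic S \<longleftrightarrow>
     (\<exists>F. finite F \<and> (\<forall>B\<in>F. basic_semialgebraic B) \<and> S = \<Union>F)"

definition semialgebraic_fun :: "('a::euclidean_space \<Rightarrow> real) \<Rightarrow> bool" where
  "semialgebraic_fun f \<longleftrightarrow> semialgebraic {(x, f x) |x. x \<in> UNIV}"

definition is_norm :: "('a::real_vector \<Rightarrow> real) \<Rightarrow> bool" where
  "is_norm \<nu> \<longleftrightarrow>
     (\<forall>x. \<nu> x \<ge> 0) \<and> (\<forall>x. \<nu> x = 0 \<longleftrightarrow> x = 0) \<and>
     (\<forall>c x. \<nu> (c *\<^sub>R x) = \<bar>c\<bar> * \<nu> x) \<and>
     (\<forall>x y. \<nu> (x + y) \<le> \<nu> x + \<nu> y)"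

text \<open>
  A minimum over a possibly infinite set, hence \<^const>\<open>Least\<close> rather than \<^const>\<open>Min\<close>. The value
  is specified only where the minimum is attained, as it is when \<open>\<nu>\<close> is a norm on R^n and
  \<open>C\<close> is nonempty and closed.
\<close>

definition dist_norm_set :: "('a::real_vector \<Rightarrow> real) \<Rightarrow> 'a \<Rightarrow> 'a set \<Rightarrow> real" where
  "dist_norm_set \<nu> x C = (LEAST r. r \<in> {\<nu> (x - y) |y. y \<in> C})"

end

theory Submission
  imports Defs "HOL-Computational_Algebra.Polynomial"
begin

text \<open>
  Since \<open>C\<close> is closed and \<open>\<nu>\<close> dominates a multiple of the Euclidean norm, the
  minimum defining the distance is attained, so \<open>r\<close> is the distance from \<open>x\<close> to
  \<open>C\<close> iff some \<open>y \<in> C\<close> has \<open>\<nu> (x - y) = r\<close> and no \<open>y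
  \<in> C\<close> has \<open>\<nu> (x - y) < r\<close>. The first condition describes a projection and the
  second the complement of a projection, of sets built from \<open>C\<close> and the graph of
  \<open>\<nu>\<close> by linear preimages and Boolean operations. Everything therefore rests on the
  Tarski-Seidenberg theorem (\<open>semialgebraic_projection\<close>): projections of semialgebraic sets are
  semialgebraic.

  That theorem is proved here without any algorithm. Let \<open>D\<close> be an algebra of subsets of a
  parameter space \<open>X\<close>, and let \<open>B\<close> be a ring of functions \<open>X \<Rightarrow>
  \<real>\<close> whose positivity sets all lie in \<open>D\<close>. By Zorn's lemma \<open>B\<close> may be
  taken maximal with this property. Maximality means that a function \<open>f\<close> belongs to
  \<open>B\<close> as soon as \<open>{x. 0 < q(x, f x)}\<close> is in \<open>D\<close> for every polynomial
  \<open>q\<close> over \<open>B\<close>. Such a ring is closed under taking roots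
  (\<open>root_cover_exists\<close>): if \<open>q\<close> is a polynomial over \<open>B\<close> in one
  variable \<open>t\<close>, finitely many members of \<open>B\<close> cover, for each \<open>x\<close>, all
  real roots of \<open>q(x, t)\<close>, unless \<open>q(x, t)\<close> vanishes identically. The proof is by
  induction on the degree. After making \<open>q\<close> monic, each root of \<open>q(x, t)\<close> either
  is a critical point or is the only root between two neighbouring critical points or root bounds, because
  \<open>q(x, t)\<close> is monotone in \<open>t\<close> between them. The position of such a root \<open>h
  x\<close> relative to any \<open>g x\<close> with \<open>g \<in> B\<close> can be read off from the signs
  of \<open>q(x, g x)\<close> and of \<open>q\<close> at the end points; hence so can the sign at \<open>h
  x\<close> of any polynomial of lower degree, whose roots are covered by induction; and polynomials of
  higher degree reduce modulo \<open>q\<close>. So \<open>h \<in> B\<close> by maximality.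

  Once the roots of all polynomials in a system are covered by members of \<open>B\<close>, solvability of
  the system in \<open>t\<close> is decided by testing finitely many sample points, each of which is again
  in \<open>B\<close>. So the set of parameters for which a solution exists is in \<open>D\<close>
  (\<open>projection_in_algebra\<close>). Applied to the semialgebraic sets and the polynomial functions,
  this eliminates one real variable; eliminating the variables along a basis one after another gives the
  projection theorem.
\<close>

section \<open>Polynomials over a ring of functions\<close>

locale function_ring =
  fixes B :: "('x \<Rightarrow> real) set"
  assumes const: "(\<lambda>x. c) \<in> B"
    and add: "f \<in> B \<Longrightarrow> g \<in> B \<Longrightarrow> (\<lambda>x. f x + g x) \<in> B"
    and mult: "f \<in> B \<Longrightarrow> g \<in> B \<Longrightarrow> (\<lambda>x. f x * g x) \<in> B"

text \<open>
  A polynomial over the ring \<open>B\<close> is encoded as a family of real polynomials, one for each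
  parameter, so that the arithmetic of univariate polynomials applies pointwise. The bound on the degree
  has to be uniform: otherwise infinitely many coefficient functions could be nonzero.
\<close>
definition poly_over :: "('x \<Rightarrow> real) set \<Rightarrow> nat \<Rightarrow> ('x \<Rightarrow> real poly) \<Rightarrow> bool" where
  "poly_over B n q \<longleftrightarrow> (\<forall>i. (\<lambda>x. coeff (q x) i) \<in> B) \<and> (\<forall>x. degree (q x) \<le> n)"

lemma poly_over_coeff: "poly_over B n q \<Longrightarrow> (\<lambda>x. coeff (q x) i) \<in> B"
  and poly_over_degree: "poly_over B n q \<Longrightarrow> degree (q x) \<le> n"
  by (auto simp: poly_over_def)

lemma poly_over_le: "poly_over B m q \<Longrightarrow> m \<le> n \<Longrightarrow> poly_over B n q"
  by (auto simp: poly_over_def intro: order_trans)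

lemma poly_over_subset: "poly_over A n q \<Longrightarrow> A \<subseteq> B \<Longrightarrow> poly_over B n q"
  by (auto simp: poly_over_def)

lemma poly_eq_sum_atMost:
  fixes p :: "'a::comm_semiring_1 poly"
  assumes "degree p \<le> n"
  shows "poly p t = (\<Sum>i\<le>n. coeff p i * t ^ i)"
  unfolding poly_altdef using assms
  by (intro sum.mono_neutral_left) (auto simp: coeff_eq_0)

context function_ring
begin

lemma uminus: "f \<in> B \<Longrightarrow> (\<lambda>x. - f x) \<in> B"
  using mult[OF const[of "-1"]] by simp

lemma diff: "f \<in> B \<Longrightarrow> g \<in> B \<Longrightarrow> (\<lambda>x. f x - g x) \<in> B"
  using add[OF _ uminus] by simp

lemma power: "f \<in> B \<Longrightarrow> (\<lambda>x. f x ^ n) \<in> B"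
  by (induction n) (auto intro: const mult)

lemma sum: "finite I \<Longrightarrow> (\<And>i. i \<in> I \<Longrightarrow> f i \<in> B) \<Longrightarrow> (\<lambda>x. \<Sum>i\<in>I. f i x) \<in> B"
  by (induction rule: finite_induct) (auto intro: const add)

lemma poly_eval:
  assumes "poly_over B n q" and "f \<in> B"
  shows "(\<lambda>x. poly (q x) (f x)) \<in> B"
proof -
  have "(\<lambda>x. \<Sum>i\<le>n. coeff (q x) i * f x ^ i) \<in> B"
    using assms by (intro sum mult power) (auto simp: poly_over_coeff)
  then show ?thesis
    using poly_eq_sum_atMost[OF poly_over_degree[OF assms(1)]] by simp
qed

lemma poly_over_add: "poly_over B n p \<Longrightarrow> poly_over B n q \<Longrightarrow> poly_over B n (\<lambda>x. p x + q x)"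
  by (auto simp: poly_over_def intro: add degree_add_le)

lemma poly_over_diff: "poly_over B n p \<Longrightarrow> poly_over B n q \<Longrightarrow> poly_over B n (\<lambda>x. p x - q x)"
  by (auto simp: poly_over_def intro: diff degree_diff_le)

lemma poly_over_mult:
  assumes "poly_over B m p" and "poly_over B n q"
  shows "poly_over B (m + n) (\<lambda>x. p x * q x)"
  unfolding poly_over_def coeff_mult
  using assms
  by (auto intro!: sum mult poly_over_coeff intro: order_trans[OF degree_mult_le] add_mono poly_over_degree)

lemma poly_over_monom: "f \<in> B \<Longrightarrow> poly_over B n (\<lambda>x. monom (f x) n)"
  unfolding poly_over_def
proof (intro conjI allI)
  show "(\<lambda>x. coeff (monom (f x) n) i) \<in> B" if "f \<in> B" for i
    using that const by (cases "n = i") simp_all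
qed (rule degree_monom_le)

lemma poly_over_smult: "f \<in> B \<Longrightarrow> poly_over B n p \<Longrightarrow> poly_over B n (\<lambda>x. smult (f x) (p x))"
  by (auto simp: poly_over_def intro: mult order_trans[OF degree_smult_le])

lemma poly_over_pderiv: "poly_over B (Suc n) p \<Longrightarrow> poly_over B n (\<lambda>x. pderiv (p x))"
  by (auto simp: poly_over_def coeff_pderiv degree_pderiv le_diff_conv intro!: mult const)

text \<open>
  The induction on the degree is an induction on the formal bound \<open>n\<close>, because the true degree
  varies with the parameter; subtracting the formal leading term lowers the bound at every parameter.
\<close>
lemma poly_over_remove_leading:
  assumes "poly_over B (Suc n) p"
  shows "poly_over B n (\<lambda>x. p x - monom (coeff (p x) (Suc n)) (Suc n))"
proof -
  have "coeff (p x - monom (coeff (p x) (Suc n)) (Suc n)) i = 0" if "i > n" for x i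
    using that poly_over_degree[OF assms, of x] by (cases "i = Suc n") (auto intro: coeff_eq_0)
  then have "degree (p x - monom (coeff (p x) (Suc n)) (Suc n)) \<le> n" for x
    by (intro degree_le) blast
  moreover have "poly_over B (Suc n) (\<lambda>x. p x - monom (coeff (p x) (Suc n)) (Suc n))"
    using assms by (intro poly_over_diff poly_over_monom poly_over_coeff)
  ultimately show ?thesis
    by (auto simp: poly_over_def)
qed

text \<open>The ring \<open>B[f]\<close> generated by \<open>f\<close> over \<open>B\<close>.\<close>
lemma adjoin_ring:
  shows "function_ring {\<lambda>x. poly (q x) (f x) |q n. poly_over B n q}" (is "function_ring ?B")
    and "B \<subseteq> {\<lambda>x. poly (q x) (f x) |q n. poly_over B n q}"
    and "f \<in> {\<lambda>x. poly (q x) (f x) |q n. poly_over B n q}"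
proof -
  have mem: "(\<lambda>x. poly (q x) (f x)) \<in> ?B" if "poly_over B n q" for q n
    using that by blast
  show sub: "B \<subseteq> ?B"
  proof
    fix g assume "g \<in> B"
    from mem[OF poly_over_monom[OF this, of 0]] show "g \<in> ?B"
      by (simp add: poly_monom)
  qed
  show "f \<in> ?B"
    using mem[OF poly_over_monom[OF const[of 1], of 1]] by (simp add: poly_monom)
  show "function_ring ?B"
  proof
    show "(\<lambda>x. c) \<in> ?B" for c
      using sub const by blast
  next
    fix g h assume "g \<in> ?B" "h \<in> ?B"
    then obtain p m q n where g: "g = (\<lambda>x. poly (p x) (f x))" and p: "poly_over B m p"
      and h: "h = (\<lambda>x. poly (q x) (f x))" and q: "poly_over B n q"
      by blast
    show "(\<lambda>x. g x * h x) \<in> ?B"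
      using mem[OF poly_over_mult[OF p q]] by (simp add: g h)
    show "(\<lambda>x. g x + h x) \<in> ?B"
      using mem[OF poly_over_add[OF poly_over_le[OF p, of "max m n"] poly_over_le[OF q]]]
      by (simp add: g h)
  qed
qed

end

section \<open>Saturated function rings\<close>

text \<open>
  The assumption \<open>saturated\<close> expresses maximality among the rings all of whose positivity sets lie
  in \<open>D\<close>: its premise says that adjoining \<open>f\<close> creates no positivity set outside \<open>D\<close>.
\<close>
locale saturated_function_ring = algebra "UNIV :: 'x set" D + function_ring B
  for D :: "'x set set" and B :: "('x \<Rightarrow> real) set" +
  assumes pos: "f \<in> B \<Longrightarrow> {x. 0 < f x} \<in> D"
    and saturated: "(\<And>q n. poly_over B n q \<Longrightarrow> {x. 0 < poly (q x) (f x)} \<in> D) \<Longrightarrow> f \<in> B"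

text \<open>
  Zorn's lemma applies because the ring operations and the condition on positivity sets involve
  at most two members at a time, so they survive unions of chains. If \<open>f\<close> meets the
  premise of saturation over a maximal ring \<open>M\<close>, then \<open>M[f]\<close> is a competitor containing \<open>M\<close>, so
  it equals \<open>M\<close>.
\<close>
lemma (in function_ring) saturation_exists:
  assumes "algebra UNIV D" and pos: "\<And>f. f \<in> B \<Longrightarrow> {x. 0 < f x} \<in> D"
  obtains B' where "B \<subseteq> B'" and "saturated_function_ring D B'"
proof -
  define \<A> where "\<A> = {A. B \<subseteq> A \<and> function_ring A \<and> (\<forall>f\<in>A. {x. 0 < f x} \<in> D)}"
  have "B \<in> \<A>"
    using pos function_ring_axioms by (auto simp: \<A>_def)
  moreover have "\<Union>\<C> \<in> \<A>" if ne: "\<C> \<noteq> {}" and ch: "subset.chain \<A> \<C>" for \<C>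
  proof -
    have sub: "\<C> \<subseteq> \<A>" and tot: "\<And>X Y. X \<in> \<C> \<Longrightarrow> Y \<in> \<C> \<Longrightarrow> X \<subseteq> Y \<or> Y \<subseteq> X"
      using ch by (auto simp: subset_chain_def)
    have common: "\<exists>X\<in>\<C>. f \<in> X \<and> g \<in> X" if "f \<in> \<Union>\<C>" "g \<in> \<Union>\<C>" for f g
      using that tot by blast
    have ring: "function_ring X" if "X \<in> \<C>" for X
      using that sub by (auto simp: \<A>_def)
    have "function_ring (\<Union>\<C>)"
    proof
      show "(\<lambda>x. c) \<in> \<Union>\<C>" for c
        using ne function_ring.const[OF ring] by blast
      show "(\<lambda>x. f x + g x) \<in> \<Union>\<C>" if "f \<in> \<Union>\<C>" "g \<in> \<Union>\<C>" for f g
        using common[OF that] function_ring.add[OF ring] by blast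
      show "(\<lambda>x. f x * g x) \<in> \<Union>\<C>" if "f \<in> \<Union>\<C>" "g \<in> \<Union>\<C>" for f g
        using common[OF that] function_ring.mult[OF ring] by blast
    qed
    moreover have "B \<subseteq> \<Union>\<C>" and "\<forall>f\<in>\<Union>\<C>. {x. 0 < f x} \<in> D"
      using ne sub by (auto simp: \<A>_def)
    ultimately show ?thesis
      by (simp add: \<A>_def)
  qed
  ultimately obtain M where M: "M \<in> \<A>" and max: "\<And>X. X \<in> \<A> \<Longrightarrow> M \<subseteq> X \<Longrightarrow> X = M"
    using subset_Zorn_nonempty[of \<A>] by blast
  interpret M: function_ring M
    using M by (simp add: \<A>_def)
  have "f \<in> M" if "\<And>q n. poly_over M n q \<Longrightarrow> {x. 0 < poly (q x) (f x)} \<in> D" for f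
  proof -
    let ?N = "{\<lambda>x. poly (q x) (f x) |q n. poly_over M n q}"
    have "?N \<in> \<A>"
      using M M.adjoin_ring(1,2)[of f] that by (auto simp: \<A>_def)
    then have "?N = M"
      using max M.adjoin_ring(2) by blast
    then show ?thesis
      using M.adjoin_ring(3) by blast
  qed
  moreover have "B \<subseteq> M" and "\<And>f. f \<in> M \<Longrightarrow> {x. 0 < f x} \<in> D"
    using M by (auto simp: \<A>_def)
  ultimately have "saturated_function_ring D M"
    using assms(1) M.function_ring_axioms
    unfolding saturated_function_ring_def saturated_function_ring_axioms_def by blast
  with \<open>B \<subseteq> M\<close> show ?thesis
    by (rule that)
qed

section \<open>Sample points\<close>

text \<open>
  At each parameter, the sample points of \<open>F\<close> meet every point and every gap of the finite set of
  values of \<open>F\<close>: midpoints serve the bounded gaps, the shifts by one the unbounded gaps, and zero the case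
  of empty \<open>F\<close>.
\<close>
definition samples :: "('x \<Rightarrow> real) set \<Rightarrow> ('x \<Rightarrow> real) set" where
  "samples F = F \<union> {\<lambda>x. 0} \<union> (\<lambda>f x. f x - 1) ` F \<union> (\<lambda>f x. f x + 1) ` F
     \<union> (\<lambda>(f, g) x. (f x + g x) / 2) ` (F \<times> F)"

lemma finite_samples: "finite F \<Longrightarrow> finite (samples F)"
  by (simp add: samples_def)

lemma sample_in_same_gap:
  fixes F :: "('x \<Rightarrow> real) set"
  assumes "finite F"
  obtains s where "s \<in> samples F" and "s x = t \<or> (\<forall>f\<in>F. f x \<notin> closed_segment (s x) t)"
proof (cases "\<exists>f\<in>F. f x = t")
  case True
  then show thesis
    using that by (auto simp: samples_def)
next
  case False
  let ?V = "(\<lambda>f. f x) ` F"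
  define L where "L = {v \<in> ?V. v < t}"
  define U where "U = {v \<in> ?V. t < v}"
  have fin: "finite L" "finite U"
    using assms by (auto simp: L_def U_def)
  have V: "v \<in> L \<or> v \<in> U" if "v \<in> ?V" for v
    using that False by (auto simp: L_def U_def)
  have L: "\<exists>f\<in>F. f x = Max L \<and> f x < t \<and> (\<forall>v\<in>L. v \<le> f x)" if "L \<noteq> {}"
    using Max_in[OF fin(1) that] Max_ge[OF fin(1)] by (auto simp: L_def)
  have U: "\<exists>f\<in>F. f x = Min U \<and> t < f x \<and> (\<forall>v\<in>U. f x \<le> v)" if "U \<noteq> {}"
    using Min_in[OF fin(2) that] Min_le[OF fin(2)] by (auto simp: U_def)
  have V': "(f x \<in> L \<and> f x < t) \<or> (f x \<in> U \<and> t < f x)" if "f \<in> F" for f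
    using V[of "f x"] that by (auto simp: L_def U_def)
  consider "L = {}" "U = {}" | "L = {}" "U \<noteq> {}" | "L \<noteq> {}" "U = {}" | "L \<noteq> {}" "U \<noteq> {}"
    by blast
  then show thesis
  proof cases
    case 1
    then have "F = {}" using V by auto
    then show thesis
      using that[of "\<lambda>x. 0"] by (simp add: samples_def)
  next
    case 2
    from U[OF 2(2)] obtain f where "f \<in> F" and f: "t < f x" "\<forall>v\<in>U. f x \<le> v"
      by blast
    have "(\<lambda>x. f x - 1) \<in> samples F"
      using \<open>f \<in> F\<close> by (auto simp: samples_def)
    moreover have "g x \<notin> closed_segment (f x - 1) t" if "g \<in> F" for g
      using V'[OF that] f 2 by (auto simp: closed_segment_eq_real_ivl split: if_splits)
    ultimately show thesis
      using that[of "\<lambda>x. f x - 1"] by blast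
  next
    case 3
    from L[OF 3(1)] obtain f where "f \<in> F" and f: "f x < t" "\<forall>v\<in>L. v \<le> f x"
      by blast
    have "(\<lambda>x. f x + 1) \<in> samples F"
      using \<open>f \<in> F\<close> by (auto simp: samples_def)
    moreover have "g x \<notin> closed_segment (f x + 1) t" if "g \<in> F" for g
      using V'[OF that] f 3 by (auto simp: closed_segment_eq_real_ivl split: if_splits)
    ultimately show thesis
      using that[of "\<lambda>x. f x + 1"] by blast
  next
    case 4
    from L[OF 4(1)] obtain f where "f \<in> F" and f: "f x < t" "\<forall>v\<in>L. v \<le> f x"
      by blast
    from U[OF 4(2)] obtain g where "g \<in> F" and g: "t < g x" "\<forall>v\<in>U. g x \<le> v"
      by blast
    have "(\<lambda>x. (f x + g x) / 2) \<in> samples F"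
      using \<open>f \<in> F\<close> \<open>g \<in> F\<close> by (auto simp: samples_def intro!: rev_image_eqI[of "(f, g)"])
    moreover have "h x \<notin> closed_segment ((f x + g x) / 2) t" if "h \<in> F" for h
    proof -
      have "h x \<le> f x \<or> g x \<le> h x"
        using V'[OF that] f(2) g(2) by blast
      then show ?thesis
        using f(1) g(1) by (auto simp: closed_segment_eq_real_ivl field_simps)
    qed
    ultimately show thesis
      using that[of "\<lambda>x. (f x + g x) / 2"] by blast
  qed
qed

text \<open>The intermediate value theorem, in the form in which it is used throughout.\<close>
lemma sgn_poly_eq_on_root_free_segment:
  fixes p :: "real poly"
  assumes "\<And>r. r \<in> closed_segment s t \<Longrightarrow> poly p r \<noteq> 0"
  shows "sgn (poly p s) = sgn (poly p t)"
proof (rule ccontr)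
  assume neq: "sgn (poly p s) \<noteq> sgn (poly p t)"
  have "poly p s \<noteq> 0" "poly p t \<noteq> 0"
    using assms by auto
  with neq have "poly p s * poly p t < 0" "poly p t * poly p s < 0"
    by (auto simp: sgn_if mult_less_0_iff split: if_splits)
  moreover have "s \<noteq> t"
    using neq by auto
  ultimately obtain r where "poly p r = 0" "r \<in> closed_segment s t"
    using poly_IVT[of s t p] poly_IVT[of t s p]
    by (cases s t rule: linorder_cases) (auto simp: closed_segment_eq_real_ivl)
  then show False
    using assms by blast
qed

text \<open>
  One sample point replaces \<open>t\<close> for all polynomials whose roots are covered by \<open>F\<close>, so it decides a
  whole system of sign conditions simultaneously.
\<close>
lemma sample_sgn_eq:
  fixes F :: "('x \<Rightarrow> real) set" and x :: 'x and t :: real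
  assumes "finite F"
  obtains s where "s \<in> samples F"
    and "\<And>p. (p \<noteq> 0 \<Longrightarrow> \<forall>r. poly p r = 0 \<longrightarrow> (\<exists>f\<in>F. r = f x)) \<Longrightarrow> sgn (poly p (s x)) = sgn (poly p t)"
proof -
  obtain s where s: "s \<in> samples F" "s x = t \<or> (\<forall>f\<in>F. f x \<notin> closed_segment (s x) t)"
    using sample_in_same_gap[OF assms] by metis
  have "sgn (poly p (s x)) = sgn (poly p t)"
    if p: "p \<noteq> 0 \<Longrightarrow> \<forall>r. poly p r = 0 \<longrightarrow> (\<exists>f\<in>F. r = f x)" for p
  proof (cases "p = 0 \<or> s x = t")
    case False
    then show ?thesis
      using p s(2) by (intro sgn_poly_eq_on_root_free_segment) auto
  qed auto
  then show thesis
    using that s(1) by blast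
qed

section \<open>Closure properties of saturated rings\<close>

context saturated_function_ring
begin

lemma Collect_conj: "{x. P x} \<in> D \<Longrightarrow> {x. Q x} \<in> D \<Longrightarrow> {x. P x \<and> Q x} \<in> D"
  and Collect_disj: "{x. P x} \<in> D \<Longrightarrow> {x. Q x} \<in> D \<Longrightarrow> {x. P x \<or> Q x} \<in> D"
  and Collect_not: "{x. P x} \<in> D \<Longrightarrow> {x. \<not> P x} \<in> D"
  using sets_Collect_conj[of Q P] sets_Collect_disj[of Q P] sets_Collect_neg[of P] by simp_all

lemma Collect_const: "{x. b} \<in> D"
  using sets_Collect_const[of b] by simp

lemma Collect_Bex: "finite I \<Longrightarrow> (\<And>i. i \<in> I \<Longrightarrow> {x. P x i} \<in> D) \<Longrightarrow> {x. \<exists>i\<in>I. P x i} \<in> D"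
  by (induction rule: finite_induct) (auto intro: Collect_const Collect_disj)

lemma Collect_Ball: "finite I \<Longrightarrow> (\<And>i. i \<in> I \<Longrightarrow> {x. P x i} \<in> D) \<Longrightarrow> {x. \<forall>i\<in>I. P x i} \<in> D"
  by (induction rule: finite_induct) (auto intro: Collect_const Collect_conj)

lemma Collect_less: "f \<in> B \<Longrightarrow> g \<in> B \<Longrightarrow> {x. f x < g x} \<in> D"
  using pos[OF diff[of g f]] by simp

lemma Collect_le: "f \<in> B \<Longrightarrow> g \<in> B \<Longrightarrow> {x. f x \<le> g x} \<in> D"
  using Collect_not[OF Collect_less[of g f]] by (simp add: not_less)

lemma Collect_eq: "f \<in> B \<Longrightarrow> g \<in> B \<Longrightarrow> {x. f x = g x} \<in> D"
  using Collect_conj[OF Collect_le[of f g] Collect_le[of g f]] by (simp add: order_eq_iff)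

lemmas Collect_intros = Collect_conj Collect_disj Collect_not Collect_const
  Collect_Bex Collect_Ball Collect_less Collect_le Collect_eq

text \<open>
  The sign of \<open>q(x, 1 / c x)\<close> does not change on multiplication by the even power \<open>c x ^ (2 * n)\<close>,
  which clears denominators. Where \<open>c x = 0\<close>, the convention \<open>inverse 0 = 0\<close> leaves the constant
  coefficient.
\<close>
lemma inverse_closed:
  assumes "c \<in> B"
  shows "(\<lambda>x. inverse (c x)) \<in> B"
proof (rule saturated)
  fix q n assume q: "poly_over B n q"
  let ?s = "\<lambda>x. \<Sum>i\<le>n. coeff (q x) i * c x ^ (2 * n - i)"
  have "0 < poly (q x) (inverse (c x)) \<longleftrightarrow> 0 < ?s x" if "c x \<noteq> 0" for x
  proof -
    have "?s x = c x ^ (2 * n) * poly (q x) (inverse (c x))"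
      unfolding poly_eq_sum_atMost[OF poly_over_degree[OF q]] sum_distrib_left
      using that by (intro sum.cong) (auto simp: power_diff field_simps)
    moreover have "0 < c x ^ (2 * n)"
      using that by (simp add: power_mult)
    ultimately show ?thesis
      by (simp add: zero_less_mult_iff)
  qed
  then have "0 < poly (q x) (inverse (c x)) \<longleftrightarrow>
      (c x = 0 \<and> 0 < coeff (q x) 0) \<or> (\<not> c x = 0 \<and> 0 < ?s x)" for x
    by (cases "c x = 0") (simp_all add: poly_0_coeff_0)
  then have "{x. 0 < poly (q x) (inverse (c x))} =
      {x. (c x = 0 \<and> 0 < coeff (q x) 0) \<or> (\<not> c x = 0 \<and> 0 < ?s x)}"
    by blast
  also have "\<dots> \<in> D"
    by (intro Collect_intros const sum mult power assms poly_over_coeff[OF q]) simp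
  finally show "{x. 0 < poly (q x) (inverse (c x))} \<in> D" .
qed

lemma samples_subset: "F \<subseteq> B \<Longrightarrow> samples F \<subseteq> B"
proof -
  assume F: "F \<subseteq> B"
  have "(\<lambda>x. (f x + g x) / 2) \<in> B" if "f \<in> F" "g \<in> F" for f g
    using mult[OF const[of "1/2"] add[of f g]] F that by auto
  then show ?thesis
    using F by (auto simp: samples_def intro!: const add diff)
qed

text \<open>
  Parameters where the polynomial vanishes identically are exempt: there every real number is a root.
\<close>
definition root_cover :: "('x \<Rightarrow> real) set \<Rightarrow> ('x \<Rightarrow> real poly) \<Rightarrow> bool" where
  "root_cover F q \<longleftrightarrow> finite F \<and> F \<subseteq> B \<and>
     (\<forall>x. q x \<noteq> 0 \<longrightarrow> (\<forall>r. poly (q x) r = 0 \<longrightarrow> (\<exists>f\<in>F. r = f x)))"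

text \<open>
  For \<open>h\<close> to have a sign condition in \<open>D\<close> it suffices to know how \<open>h\<close> compares with the members of
  \<open>B\<close>: \<open>q\<close> is positive at \<open>h x\<close> iff it is positive at some sample point that either equals \<open>h x\<close>
  or is separated from \<open>h x\<close> by no member of the root cover.
\<close>
lemma positive_at_cut:
  assumes q: "poly_over B n q" and F: "root_cover F q"
    and lower: "\<And>g. g \<in> B \<Longrightarrow> {x. g x < h x} \<in> D"
    and upper: "\<And>g. g \<in> B \<Longrightarrow> {x. h x < g x} \<in> D"
  shows "{x. 0 < poly (q x) (h x)} \<in> D"
proof -
  have F: "finite F" "F \<subseteq> B"
    and roots: "\<And>x r. q x \<noteq> 0 \<Longrightarrow> poly (q x) r = 0 \<Longrightarrow> \<exists>f\<in>F. r = f x"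
    using F by (auto simp: root_cover_def)
  have sB: "s \<in> B" if "s \<in> samples F" for s
    using that samples_subset[OF F(2)] by blast
  \<comment> \<open>Membership of \<open>f x\<close> in the segment from \<open>s x\<close> to \<open>h x\<close>, written with strict comparisons
    against \<open>h x\<close> only, since those are the ones known to be in \<open>D\<close>.\<close>
  let ?between = "\<lambda>x s f. (s x \<le> f x \<and> \<not> h x < f x) \<or> (\<not> f x < h x \<and> f x \<le> s x)"
  have seg: "?between x s f \<longleftrightarrow> f x \<in> closed_segment (s x) (h x)" for x s f
    by (auto simp: closed_segment_eq_real_ivl)
  have "0 < poly (q x) (h x) \<longleftrightarrow> (\<exists>s\<in>samples F. 0 < poly (q x) (s x) \<and>
      ((\<not> s x < h x \<and> \<not> h x < s x) \<or> (\<forall>f\<in>F. \<not> ?between x s f)))" (is "_ = ?R x") for x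
  proof
    assume *: "0 < poly (q x) (h x)"
    obtain s where s: "s \<in> samples F"
      and free: "s x = h x \<or> (\<forall>f\<in>F. f x \<notin> closed_segment (s x) (h x))"
      using sample_in_same_gap[OF F(1)] by metis
    have "sgn (poly (q x) (s x)) = sgn (poly (q x) (h x))"
      using free
    proof
      assume free: "\<forall>f\<in>F. f x \<notin> closed_segment (s x) (h x)"
      have "q x \<noteq> 0" using * by auto
      then show ?thesis
        using roots free by (intro sgn_poly_eq_on_root_free_segment) blast
    qed simp
    with * have "0 < poly (q x) (s x)"
      by (simp add: sgn_if split: if_splits)
    then show "?R x"
      using s free seg by (intro bexI[of _ s]) auto
  next
    assume "?R x"
    then obtain s where s: "0 < poly (q x) (s x)"
      and free: "s x = h x \<or> (\<forall>f\<in>F. f x \<notin> closed_segment (s x) (h x))"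
      unfolding seg by auto
    have "sgn (poly (q x) (s x)) = sgn (poly (q x) (h x))"
      using free
    proof
      assume free: "\<forall>f\<in>F. f x \<notin> closed_segment (s x) (h x)"
      have "q x \<noteq> 0" using s by auto
      then show ?thesis
        using roots free by (intro sgn_poly_eq_on_root_free_segment) blast
    qed simp
    with s show "0 < poly (q x) (h x)"
      by (simp add: sgn_if split: if_splits)
  qed
  moreover have "{x. ?R x} \<in> D"
    by (intro Collect_intros finite_samples F(1) poly_eval[OF q] const lower upper)
      (use sB F in auto)
  ultimately show ?thesis
    by simp
qed

text \<open>One step of division with remainder by the monic polynomial \<open>t ^ Suc d + r\<close>.\<close>
lemma reduce_mod_monic:
  fixes r :: "'x \<Rightarrow> real poly"
  assumes q: "poly_over B (Suc (k + d)) q" and r: "poly_over B d r"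
  obtains q' where "poly_over B (k + d) q'"
    and "\<And>x t. poly (monom 1 (Suc d) + r x) t = 0 \<Longrightarrow> poly (q' x) t = poly (q x) t"
proof
  let ?n = "Suc (k + d)"
  let ?a = "\<lambda>x. coeff (q x) ?n"
  let ?q' = "\<lambda>x. (q x - monom (?a x) ?n) - smult (?a x) (monom 1 k * r x)"
  show "poly_over B (k + d) ?q'"
    by (intro poly_over_diff poly_over_remove_leading[OF q] poly_over_smult poly_over_mult
        poly_over_monom const r poly_over_coeff[OF q])
  fix x t
  assume "poly (monom 1 (Suc d) + r x) t = 0"
  then have "poly (r x) t = - (t ^ Suc d)"
    by (simp add: poly_monom)
  then show "poly (?q' x) t = poly (q x) t"
    by (simp add: poly_monom power_add)
qed

lemma root_in_monotone_gap:
  fixes p :: "real poly"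
  assumes "l < u" and "poly p l * poly p u < 0"
    and no_crit: "\<And>r. l < r \<Longrightarrow> r < u \<Longrightarrow> poly (pderiv p) r \<noteq> 0"
  shows "\<exists>!t. l < t \<and> t < u \<and> poly p t = 0"
proof -
  obtain t where t: "l < t" "t < u" "poly p t = 0"
    using poly_IVT[OF assms(1,2)] by blast
  have "False" if "l < a" "a < b" "b < u" "poly p a = 0" "poly p b = 0" for a b
    using poly_MVT[OF that(2), of p] no_crit that by force
  then have "s = t" if "l < s" "s < u" "poly p s = 0" for s
    using t that by (cases s t rule: linorder_cases) blast+
  with t show ?thesis
    by blast
qed

text \<open>
  The position of the root \<open>h\<close> relative to an arbitrary \<open>g\<close> is expressed without mentioning \<open>h\<close>:
  on the gap the polynomial changes sign exactly at \<open>h\<close>, so beyond \<open>h\<close> it has the same sign as at \<open>u\<close>.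
\<close>
lemma gap_root_less_iff:
  fixes p :: "real poly"
  assumes "l < u" and change: "poly p l * poly p u < 0"
    and no_crit: "\<And>r. l < r \<Longrightarrow> r < u \<Longrightarrow> poly (pderiv p) r \<noteq> 0"
    and h: "l < h" "h < u" "poly p h = 0"
  shows "h < g \<longleftrightarrow> u \<le> g \<or> (l < g \<and> 0 < poly p g * poly p u)"
proof -
  have uniq: "r = h" if "l < r" "r < u" "poly p r = 0" for r
    using root_in_monotone_gap[OF assms(1,2) no_crit] h that by blast
  have "g \<le> l \<or> u \<le> g \<or> g = h \<or> (l < g \<and> g < h) \<or> (h < g \<and> g < u)"
    by linarith
  then consider "g \<le> l" | "u \<le> g" | "g = h" | "l < g" "g < h" | "h < g" "g < u"
    by blast
  then show ?thesis
  proof cases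
    case 4
    have "\<not> 0 < poly p g * poly p u"
    proof
      assume "0 < poly p g * poly p u"
      with change have "poly p l * poly p g < 0"
        by (auto simp: mult_less_0_iff zero_less_mult_iff)
      from poly_IVT[OF 4(1) this] obtain r where "l < r" "r < g" "poly p r = 0"
        by blast
      moreover from this have "r = h"
        using uniq[of r] 4 h by linarith
      ultimately show False
        using 4 by linarith
    qed
    then show ?thesis using 4 h by auto
  next
    case 5
    have "poly p u \<noteq> 0"
      using change by auto
    moreover have "poly p r \<noteq> 0" if "g \<le> r" "r < u" for r
    proof
      assume "poly p r = 0"
      then have "r = h"
        using uniq[of r] that 5 h by linarith
      then show False
        using that 5 by linarith
    qed
    ultimately have "poly p r \<noteq> 0" if "r \<in> closed_segment g u" for r
      using that 5 by (cases "r = u") (auto simp: closed_segment_eq_real_ivl)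
    then have "sgn (poly p g) = sgn (poly p u)"
      by (rule sgn_poly_eq_on_root_free_segment)
    with \<open>poly p u \<noteq> 0\<close> have "0 < poly p g * poly p u"
      by (auto simp: sgn_if zero_less_mult_iff split: if_splits)
    then show ?thesis using 5 h by auto
  qed (use h in auto)
qed

text \<open>
  This is where saturation produces new elements. The function \<open>h\<close> selects the root in the gap between
  \<open>l\<close> and \<open>u\<close> at those parameters where the gap contains no critical point and \<open>p\<close> changes sign over it.
  Comparisons of \<open>h\<close> with members of \<open>B\<close> are in \<open>D\<close> by the preceding lemma, which settles the
  polynomials of degree at most \<open>d\<close>, as their roots are covered. For higher degrees one reduces
  modulo \<open>p\<close>, which does not change the value at a root of \<open>p\<close>.
\<close>
lemma gap_root_in_ring:
  fixes r :: "'x \<Rightarrow> real poly" and d :: nat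
  defines "p \<equiv> \<lambda>x. monom 1 (Suc d) + r x"
  assumes cover: "\<And>q. poly_over B d q \<Longrightarrow> \<exists>F. root_cover F q"
    and r: "poly_over B d r" and E: "finite E" "E \<subseteq> B"
    and crit: "\<And>x t. poly (pderiv (p x)) t = 0 \<Longrightarrow> \<exists>e\<in>E. t = e x"
    and l: "l \<in> B" and u: "u \<in> B"
  obtains h where "h \<in> B"
    and "\<And>x t. (\<forall>e\<in>E. \<not> (l x < e x \<and> e x < u x)) \<Longrightarrow> poly (p x) (l x) * poly (p x) (u x) < 0 \<Longrightarrow>
      l x < t \<Longrightarrow> t < u x \<Longrightarrow> poly (p x) t = 0 \<Longrightarrow> h x = t"
proof -
  have p: "poly_over B (Suc d) p"
    unfolding p_def by (intro poly_over_add poly_over_monom const poly_over_le[OF r]) simp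
  define C where "C = (\<lambda>x. l x < u x \<and> (\<forall>e\<in>E. \<not> (l x < e x \<and> e x < u x)) \<and>
    poly (p x) (l x) * poly (p x) (u x) < 0)"
  \<comment> \<open>Off \<open>C\<close> any member of \<open>B\<close> would do as value of \<open>h\<close>; zero keeps the sign conditions simple.\<close>
  define h where "h = (\<lambda>x. if C x then (THE t. l x < t \<and> t < u x \<and> poly (p x) t = 0) else 0)"
  have no_crit: "poly (pderiv (p x)) t \<noteq> 0" if "C x" "l x < t" "t < u x" for x t
    using crit that by (auto simp: C_def)
  have ex1: "\<exists>!t. l x < t \<and> t < u x \<and> poly (p x) t = 0" if "C x" for x
    using no_crit[OF that] that unfolding C_def by (intro root_in_monotone_gap) auto
  have h: "l x < h x" "h x < u x" "poly (p x) (h x) = 0" if "C x" for x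
    using theI'[OF ex1[OF that]] that by (auto simp: h_def)
  have CD: "{x. C x} \<in> D"
    unfolding C_def using E
    by (intro Collect_intros mult const poly_eval[OF p] l u) auto
  have less: "h x < g x \<longleftrightarrow> u x \<le> g x \<or> (l x < g x \<and> 0 < poly (p x) (g x) * poly (p x) (u x))"
    if "C x" for x g
    using no_crit[OF that] h[OF that] that unfolding C_def by (intro gap_root_less_iff) auto
  have eq: "h x = g x \<longleftrightarrow> l x < g x \<and> g x < u x \<and> poly (p x) (g x) = 0" if "C x" for x g
    using h[OF that] ex1[OF that] by metis
  have upper: "{x. h x < g x} \<in> D" if g: "g \<in> B" for g
  proof -
    have "{x. h x < g x} = {x. (C x \<and> (u x \<le> g x \<or> (l x < g x \<and> 0 < poly (p x) (g x) * poly (p x) (u x))))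
        \<or> (\<not> C x \<and> 0 < g x)}"
      using less by (auto simp: h_def)
    also have "\<dots> \<in> D"
      by (intro Collect_intros CD mult const poly_eval[OF p] l u g)
    finally show ?thesis .
  qed
  have lower: "{x. g x < h x} \<in> D" if g: "g \<in> B" for g
  proof -
    have "{x. h x = g x} = {x. (C x \<and> l x < g x \<and> g x < u x \<and> poly (p x) (g x) = 0) \<or> (\<not> C x \<and> 0 = g x)}"
      using eq by (auto simp: h_def)
    also have "\<dots> \<in> D"
      by (intro Collect_intros CD const poly_eval[OF p] l u g)
    finally have "{x. \<not> (h x < g x \<or> h x = g x)} \<in> D"
      by (intro Collect_not Collect_disj upper g)
    then show ?thesis
      by (simp add: not_le flip: le_less)
  qed
  have "{x. 0 < poly (q x) (h x)} \<in> D" if "poly_over B (k + d) q" for q k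
    using that
  proof (induction k arbitrary: q)
    case 0
    then have q: "poly_over B d q" by simp
    then show ?case
      using cover positive_at_cut[OF q _ lower upper] by blast
  next
    case (Suc k)
    then have q: "poly_over B (Suc (k + d)) q" by simp
    from reduce_mod_monic[OF q r] obtain q' where q': "poly_over B (k + d) q'"
      and eq: "\<And>x t. poly (p x) t = 0 \<Longrightarrow> poly (q' x) t = poly (q x) t"
      unfolding p_def by blast
    have "{x. 0 < poly (q x) (h x)} =
        {x. (C x \<and> 0 < poly (q' x) (h x)) \<or> (\<not> C x \<and> 0 < poly (q x) 0)}"
      using eq[OF h(3)] by (auto simp: h_def)
    also have "\<dots> \<in> D"
      by (intro Collect_intros CD Suc.IH[OF q'] const poly_eval[OF q])
    finally show ?case .
  qed
  then have "h \<in> B"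
    using poly_over_le le_add1 by (intro saturated) blast
  moreover have "h x = t" if "\<forall>e\<in>E. \<not> (l x < e x \<and> e x < u x)" "poly (p x) (l x) * poly (p x) (u x) < 0"
    "l x < t" "t < u x" "poly (p x) t = 0" for x t
  proof -
    have "C x" using that by (auto simp: C_def)
    then show ?thesis using h[of x] ex1[of x] that by blast
  qed
  ultimately show thesis
    using that by blast
qed

end

section \<open>Saturated rings contain the roots of their polynomials\<close>

text \<open>
  A variant of Cauchy's bound. With squares in place of absolute values, it is a polynomial in the
  coefficients, so it belongs to any function ring containing them.
\<close>
lemma monic_root_bound:
  fixes r :: "real poly"
  assumes deg: "degree r \<le> d" and root: "poly (monom 1 (Suc d) + r) t = 0"
  shows "\<bar>t\<bar> < 1 + (\<Sum>i\<le>d. coeff r i ^ 2 + 1)"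
proof (rule ccontr)
  let ?S = "\<Sum>i\<le>d. coeff r i ^ 2 + 1"
  assume "\<not> ?thesis"
  then have large: "1 + ?S \<le> \<bar>t\<bar>"
    by simp
  have "0 \<le> ?S"
    by (intro sum_nonneg) simp
  with large have t: "1 \<le> \<bar>t\<bar>"
    by linarith
  \<comment> \<open>From \<open>0 \<le> (\<bar>a\<bar> - 1/2)\<^sup>2\<close>.\<close>
  have coeff_le: "\<bar>a\<bar> \<le> a\<^sup>2 + 1" for a :: real
    using zero_le_power2[of "\<bar>a\<bar> - 1/2"] by (simp add: power2_eq_square algebra_simps)
  have "t ^ Suc d = - poly r t"
    using root by (simp add: poly_monom)
  then have "\<bar>t\<bar> ^ Suc d = \<bar>poly r t\<bar>"
    by (metis abs_minus_cancel power_abs)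
  also have "\<dots> = \<bar>\<Sum>i\<le>d. coeff r i * t ^ i\<bar>"
    by (simp add: poly_eq_sum_atMost[OF deg])
  also have "\<dots> \<le> (\<Sum>i\<le>d. \<bar>coeff r i\<bar> * \<bar>t\<bar> ^ i)"
    by (rule order_trans[OF sum_abs]) (simp add: abs_mult power_abs)
  also have "\<dots> \<le> (\<Sum>i\<le>d. (coeff r i ^ 2 + 1) * \<bar>t\<bar> ^ d)"
    using t coeff_le by (intro sum_mono mult_mono power_increasing) auto
  also have "\<dots> = ?S * \<bar>t\<bar> ^ d"
    by (simp add: sum_distrib_right)
  also have "\<dots> < \<bar>t\<bar> * \<bar>t\<bar> ^ d"
    using large t by (intro mult_strict_right_mono zero_less_power) linarith+
  finally show False
    by simp
qed

text \<open>
  Without critical points between \<open>l\<close> and \<open>u\<close> the derivative keeps its sign, so by the mean value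
  theorem the polynomial takes opposite signs on the two sides of its root.
\<close>
lemma simple_root_sign_change:
  fixes p :: "real poly"
  assumes "l < t" "t < u" and root: "poly p t = 0"
    and no_crit: "\<And>r. l < r \<Longrightarrow> r < u \<Longrightarrow> poly (pderiv p) r \<noteq> 0"
  shows "poly p l * poly p u < 0"
proof -
  obtain a where a: "l < a" "a < t" "poly p t - poly p l = (t - l) * poly (pderiv p) a"
    using poly_MVT[OF assms(1), of p] by blast
  obtain b where b: "t < b" "b < u" "poly p u - poly p t = (u - t) * poly (pderiv p) b"
    using poly_MVT[OF assms(2), of p] by blast
  have "sgn (poly (pderiv p) a) = sgn (poly (pderiv p) b)"
    using a b no_crit by (intro sgn_poly_eq_on_root_free_segment) (auto simp: closed_segment_eq_real_ivl)
  moreover have "poly (pderiv p) a \<noteq> 0"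
    using no_crit a b by auto
  ultimately have "0 < poly (pderiv p) a * poly (pderiv p) b"
    by (auto simp: sgn_if zero_less_mult_iff split: if_splits)
  then have "0 < ((t - l) * (u - t)) * (poly (pderiv p) a * poly (pderiv p) b)"
    by (rule mult_pos_pos[rotated]) (use assms(1,2) in simp)
  also have "\<dots> = - (poly p l * poly p u)"
  proof -
    have "(t - l) * poly (pderiv p) a = - poly p l" and "(u - t) * poly (pderiv p) b = poly p u"
      using a(3) b(3) root by simp_all
    then show ?thesis
      by (metis mult.assoc mult.left_commute mult_minus_left)
  qed
  finally show ?thesis
    by simp
qed

context saturated_function_ring
begin

text \<open>
  The cover consists of the critical points \<open>E\<close> and, for every pair of members of \<open>E\<close> and the two root
  bounds, the root selected in the gap between them. A root that is not critical lies in the gap between its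
  nearest neighbours, where the polynomial changes sign. The root bounds ensure that these neighbours
  exist. Being monic matters twice: the derivative vanishes identically at no parameter, so
  \<open>E\<close> catches all critical points, and the root bound needs no division.
\<close>
lemma monic_root_cover:
  fixes r :: "'x \<Rightarrow> real poly" and d :: nat
  defines "p \<equiv> \<lambda>x. monom 1 (Suc d) + r x"
  assumes cover: "\<And>q. poly_over B d q \<Longrightarrow> \<exists>F. root_cover F q"
    and r: "poly_over B d r"
  shows "\<exists>F. root_cover F p"
proof -
  have p: "poly_over B (Suc d) p"
    unfolding p_def by (intro poly_over_add poly_over_monom const poly_over_le[OF r]) simp
  obtain E where "root_cover E (\<lambda>x. pderiv (p x))"
    using cover[OF poly_over_pderiv[OF p]] by blast
  moreover have "pderiv (p x) \<noteq> 0" for x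
  proof -
    have "coeff (r x) (Suc d) = 0"
      using poly_over_degree[OF r, of x] by (intro coeff_eq_0) simp
    then have "coeff (pderiv (p x)) d \<noteq> 0"
      by (simp add: coeff_pderiv p_def del: of_nat_Suc)
    then show ?thesis
      by auto
  qed
  ultimately have E: "finite E" "E \<subseteq> B"
    and crit: "\<And>x t. poly (pderiv (p x)) t = 0 \<Longrightarrow> \<exists>e\<in>E. t = e x"
    by (auto simp: root_cover_def)
  define M where "M = (\<lambda>x. 1 + (\<Sum>i\<le>d. coeff (r x) i ^ 2 + 1))"
  have "M \<in> B"
    unfolding M_def by (intro add const sum power poly_over_coeff[OF r]) simp
  have bound: "\<bar>t\<bar> < M x" if "poly (p x) t = 0" for x t
    using monic_root_bound[OF poly_over_degree[OF r]] that by (simp add: M_def p_def)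
  let ?E = "insert M (insert (\<lambda>x. - M x) E)"
  have E': "finite ?E" "?E \<subseteq> B"
    using E \<open>M \<in> B\<close> uminus by auto
  define gap_root where "gap_root = (\<lambda>l u h. h \<in> B \<and> (\<forall>x t. (\<forall>e\<in>E. \<not> (l x < e x \<and> e x < u x)) \<longrightarrow>
      poly (p x) (l x) * poly (p x) (u x) < 0 \<longrightarrow> l x < t \<longrightarrow> t < u x \<longrightarrow> poly (p x) t = 0 \<longrightarrow> h x = t))"
  have "\<exists>h. gap_root l u h" if "l \<in> ?E" "u \<in> ?E" for l u
  proof -
    have "l \<in> B" "u \<in> B"
      using that E'(2) by blast+
    show ?thesis
    proof (rule gap_root_in_ring[OF cover r E crit[unfolded p_def] \<open>l \<in> B\<close> \<open>u \<in> B\<close>])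
      fix h
      assume "h \<in> B"
        and "\<And>x t. \<forall>e\<in>E. \<not> (l x < e x \<and> e x < u x) \<Longrightarrow>
          poly (monom 1 (Suc d) + r x) (l x) * poly (monom 1 (Suc d) + r x) (u x) < 0 \<Longrightarrow>
          l x < t \<Longrightarrow> t < u x \<Longrightarrow> poly (monom 1 (Suc d) + r x) t = 0 \<Longrightarrow> h x = t"
      then have "gap_root l u h"
        unfolding gap_root_def p_def by simp
      then show "\<exists>h. gap_root l u h"
        by blast
    qed
  qed
  then obtain H where H: "\<And>l u. l \<in> ?E \<Longrightarrow> u \<in> ?E \<Longrightarrow> gap_root l u (H l u)"
    by metis
  have HB: "H l u \<in> B" if "l \<in> ?E" "u \<in> ?E" for l u
    using H[OF that] by (simp add: gap_root_def)
  let ?F = "E \<union> (\<lambda>(l, u). H l u) ` (?E \<times> ?E)"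
  have "\<exists>f\<in>?F. t = f x" if t: "poly (p x) t = 0" for x t
  proof (cases "\<exists>e\<in>E. t = e x")
    case False
    define L where "L = (\<lambda>e. e x) ` {e \<in> ?E. e x < t}"
    define U where "U = (\<lambda>e. e x) ` {e \<in> ?E. t < e x}"
    have fin: "finite L" "finite U"
      using E by (auto simp: L_def U_def)
    have "L \<noteq> {}" "U \<noteq> {}"
      using bound[OF t] by (auto simp: L_def U_def)
    have L: "\<exists>e\<in>?E. e x < t \<and> e x = y" if "y \<in> L" for y
      using that unfolding L_def image_iff by fastforce
    have U: "\<exists>e\<in>?E. t < e x \<and> e x = y" if "y \<in> U" for y
      using that unfolding U_def image_iff by fastforce
    obtain l where l: "l \<in> ?E" "l x < t" "l x = Max L"
      using L[OF Max_in[OF fin(1) \<open>L \<noteq> {}\<close>]] by blast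
    obtain u where u: "u \<in> ?E" "t < u x" "u x = Min U"
      using U[OF Min_in[OF fin(2) \<open>U \<noteq> {}\<close>]] by blast
    have gap: "\<not> (l x < e x \<and> e x < u x)" if "e \<in> E" for e
    proof (cases "e x < t")
      case True
      then have "e x \<in> L"
        using that by (auto simp: L_def)
      then show ?thesis
        using Max_ge[OF fin(1)] l by fastforce
    next
      case False
      then have "e x \<in> U"
        using that \<open>\<not> (\<exists>e\<in>E. t = e x)\<close> by (force simp: U_def)
      then show ?thesis
        using Min_le[OF fin(2)] u by fastforce
    qed
    then have "poly (p x) (l x) * poly (p x) (u x) < 0"
      using crit by (intro simple_root_sign_change[OF l(2) u(2) t]) blast
    then have "H l u x = t"
      using H[OF l(1) u(1)] l(2) u(2) gap t unfolding gap_root_def by blast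
    then show ?thesis
      using l(1) u(1) by (intro bexI[of _ "H l u"]) auto
  qed auto
  moreover have "finite ?F"
    using E(1) E'(1) by (intro finite_UnI finite_imageI finite_cartesian_product)
  moreover have "?F \<subseteq> B"
    using E(2) HB by fast
  ultimately have "root_cover ?F p"
    unfolding root_cover_def by (intro conjI allI impI)
  then show ?thesis ..
qed

text \<open>
  Where the formal leading coefficient \<open>?c x\<close> vanishes, the polynomial agrees with one of smaller
  formal degree. Elsewhere, dividing by \<open>?c x\<close> makes it monic. Since \<open>inverse 0 = 0\<close>, the monic polynomial is
  defined over the ring at all parameters.
\<close>
lemma root_cover_exists: "poly_over B d q \<Longrightarrow> \<exists>F. root_cover F q"
proof (induction d arbitrary: q)
  case 0
  then have "degree (q x) = 0" for x
    using poly_over_degree[OF 0, of x] by simp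
  then have "root_cover {} q"
    unfolding root_cover_def using poly_zero by blast
  then show ?case ..
next
  case (Suc d)
  let ?c = "\<lambda>x. coeff (q x) (Suc d)"
  let ?q = "\<lambda>x. q x - monom (?c x) (Suc d)"
  let ?r = "\<lambda>x. smult (inverse (?c x)) (?q x)"
  have q': "poly_over B d ?q"
    by (rule poly_over_remove_leading[OF Suc.prems])
  obtain F where F: "root_cover F ?q"
    using Suc.IH[OF q'] by blast
  have "poly_over B d ?r"
    by (intro poly_over_smult q' inverse_closed poly_over_coeff[OF Suc.prems])
  from monic_root_cover[OF Suc.IH this] obtain G where
    G: "root_cover G (\<lambda>x. monom 1 (Suc d) + ?r x)" by blast
  have "\<exists>f\<in>F \<union> G. t = f x" if "q x \<noteq> 0" "poly (q x) t = 0" for x t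
  proof (cases "?c x = 0")
    case True
    then have "?q x = q x"
      by simp
    then show ?thesis
      using F that unfolding root_cover_def by (metis UnI1)
  next
    case False
    then have "q x = smult (?c x) (monom 1 (Suc d) + ?r x)"
      by (simp add: smult_add_right smult_monom)
    then have "poly (monom 1 (Suc d) + ?r x) t = 0" "monom 1 (Suc d) + ?r x \<noteq> 0"
      using that False by (metis mult_eq_0_iff poly_smult, metis smult_0_right)
    then show ?thesis
      using G unfolding root_cover_def by (metis UnI2)
  qed
  then have "root_cover (F \<union> G) q"
    using F G by (auto simp: root_cover_def)
  then show ?case ..
qed

lemma exists_solution_in_algebra:
  assumes "finite P" "finite Q" and poly: "\<And>q. q \<in> P \<union> Q \<Longrightarrow> \<exists>n. poly_over B n q"
  shows "{x. \<exists>t. (\<forall>p\<in>P. poly (p x) t = 0) \<and> (\<forall>q\<in>Q. 0 < poly (q x) t)} \<in> D"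
proof -
  have "\<forall>q\<in>P \<union> Q. \<exists>F. root_cover F q"
    using poly root_cover_exists by blast
  then obtain R where R: "\<And>q. q \<in> P \<union> Q \<Longrightarrow> root_cover (R q) q"
    by metis
  define F where "F = (\<Union>q\<in>P \<union> Q. R q)"
  have F: "finite F" "F \<subseteq> B"
    using R assms(1,2) by (auto simp: F_def root_cover_def)
  have roots: "\<forall>r. poly (q x) r = 0 \<longrightarrow> (\<exists>f\<in>F. r = f x)" if "q \<in> P \<union> Q" "q x \<noteq> 0" for q x
    using R[OF that(1)] that unfolding root_cover_def F_def by blast
  have "(\<exists>t. (\<forall>p\<in>P. poly (p x) t = 0) \<and> (\<forall>q\<in>Q. 0 < poly (q x) t)) \<longleftrightarrow>
      (\<exists>s\<in>samples F. (\<forall>p\<in>P. poly (p x) (s x) = 0) \<and> (\<forall>q\<in>Q. 0 < poly (q x) (s x)))" for x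
  proof
    assume "\<exists>t. (\<forall>p\<in>P. poly (p x) t = 0) \<and> (\<forall>q\<in>Q. 0 < poly (q x) t)"
    then obtain t where t: "\<And>p. p \<in> P \<Longrightarrow> poly (p x) t = 0" "\<And>q. q \<in> Q \<Longrightarrow> 0 < poly (q x) t"
      by blast
    obtain s where s: "s \<in> samples F"
      and sgn: "\<And>p. (p \<noteq> 0 \<Longrightarrow> \<forall>r. poly p r = 0 \<longrightarrow> (\<exists>f\<in>F. r = f x)) \<Longrightarrow> sgn (poly p (s x)) = sgn (poly p t)"
      using sample_sgn_eq[OF F(1)] by blast
    have "sgn (poly (q x) (s x)) = sgn (poly (q x) t)" if "q \<in> P \<union> Q" for q
      using roots[OF that] sgn by blast
    then have "(\<forall>p\<in>P. poly (p x) (s x) = 0) \<and> (\<forall>q\<in>Q. 0 < poly (q x) (s x))"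
      using t by (metis UnCI sgn_0_0 sgn_greater)
    with s show "\<exists>s\<in>samples F. (\<forall>p\<in>P. poly (p x) (s x) = 0) \<and> (\<forall>q\<in>Q. 0 < poly (q x) (s x))"
      by blast
  qed blast
  moreover have "(\<lambda>x. poly (q x) (s x)) \<in> B" if "q \<in> P \<union> Q" "s \<in> samples F" for q s
    using poly[OF that(1)] samples_subset[OF F(2)] that(2) poly_eval by blast
  then have "{x. \<exists>s\<in>samples F. (\<forall>p\<in>P. poly (p x) (s x) = 0) \<and> (\<forall>q\<in>Q. 0 < poly (q x) (s x))} \<in> D"
    by (intro Collect_intros finite_samples F(1) assms(1,2) const) auto
  ultimately show ?thesis
    by simp
qed

end

text \<open>
  The ring only has to be enlarged for the proof: its saturation has the same algebra \<open>D\<close>, so the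
  conclusion descends to \<open>B\<close>.
\<close>
theorem (in function_ring) projection_in_algebra:
  assumes "algebra UNIV D" and "\<And>f. f \<in> B \<Longrightarrow> {x. 0 < f x} \<in> D"
    and "finite P" "finite Q" and poly: "\<And>q. q \<in> P \<union> Q \<Longrightarrow> \<exists>n. poly_over B n q"
  shows "{x. \<exists>t. (\<forall>p\<in>P. poly (p x) t = 0) \<and> (\<forall>q\<in>Q. 0 < poly (q x) t)} \<in> D"
proof -
  obtain B' where "B \<subseteq> B'" and "saturated_function_ring D B'"
    using saturation_exists[OF assms(1,2)] by blast
  then interpret S: saturated_function_ring D B'
    by blast
  show ?thesis
    using poly_over_subset[OF _ \<open>B \<subseteq> B'\<close>] poly
    by (intro S.exists_solution_in_algebra assms(3,4)) blast
qed

section \<open>The algebra of semialgebraic sets\<close>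

lemma basic_semialgebraic_imp_semialgebraic: "basic_semialgebraic S \<Longrightarrow> semialgebraic S"
  unfolding semialgebraic_def by (intro exI[of _ "{S}"]) auto

lemma semialgebraic_zero_set:
  assumes "real_polynomial_function p"
  shows "semialgebraic {x. p x = 0}"
proof (rule basic_semialgebraic_imp_semialgebraic)
  show "basic_semialgebraic {x. p x = 0}"
    unfolding basic_semialgebraic_def
    by (rule exI[of _ "{p}"], rule exI[of _ "{}"]) (simp add: assms)
qed

lemma semialgebraic_positive_set:
  assumes "real_polynomial_function p"
  shows "semialgebraic {x. 0 < p x}"
proof (rule basic_semialgebraic_imp_semialgebraic)
  show "basic_semialgebraic {x. 0 < p x}"
    unfolding basic_semialgebraic_def
    by (rule exI[of _ "{}"], rule exI[of _ "{p}"]) (simp add: assms)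
qed

lemma semialgebraic_empty: "semialgebraic {}"
  unfolding semialgebraic_def by (intro exI[of _ "{}"]) auto

lemma semialgebraic_UNIV: "semialgebraic UNIV"
  using semialgebraic_zero_set[of "\<lambda>x. 0"] by auto

lemma semialgebraic_Un: "semialgebraic S \<Longrightarrow> semialgebraic T \<Longrightarrow> semialgebraic (S \<union> T)"
  unfolding semialgebraic_def by (metis Un_iff Union_Un_distrib finite_UnI)

lemma semialgebraic_UN: "finite I \<Longrightarrow> (\<And>i. i \<in> I \<Longrightarrow> semialgebraic (S i)) \<Longrightarrow> semialgebraic (\<Union>i\<in>I. S i)"
  by (induction rule: finite_induct) (auto intro: semialgebraic_empty semialgebraic_Un)

lemma basic_semialgebraic_Int:
  assumes "basic_semialgebraic S" "basic_semialgebraic T"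
  shows "basic_semialgebraic (S \<inter> T)"
proof -
  obtain P Q where S: "finite P" "finite Q" "\<forall>p\<in>P. real_polynomial_function p"
    "\<forall>q\<in>Q. real_polynomial_function q" "S = {x. (\<forall>p\<in>P. p x = 0) \<and> (\<forall>q\<in>Q. q x > 0)}"
    using assms(1) unfolding basic_semialgebraic_def by blast
  obtain P' Q' where T: "finite P'" "finite Q'" "\<forall>p\<in>P'. real_polynomial_function p"
    "\<forall>q\<in>Q'. real_polynomial_function q" "T = {x. (\<forall>p\<in>P'. p x = 0) \<and> (\<forall>q\<in>Q'. q x > 0)}"
    using assms(2) unfolding basic_semialgebraic_def by blast
  show ?thesis
    unfolding basic_semialgebraic_def
    by (rule exI[of _ "P \<union> P'"], rule exI[of _ "Q \<union> Q'"]) (use S T in auto)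
qed

lemma semialgebraic_Int:
  assumes "semialgebraic S" "semialgebraic T"
  shows "semialgebraic (S \<inter> T)"
proof -
  obtain F G where F: "finite F" "\<forall>A\<in>F. basic_semialgebraic A" "S = \<Union>F"
    and G: "finite G" "\<forall>A\<in>G. basic_semialgebraic A" "T = \<Union>G"
    using assms unfolding semialgebraic_def by blast
  have "semialgebraic (\<Union>(A, A')\<in>F \<times> G. A \<inter> A')"
    using F G
    by (intro semialgebraic_UN)
      (auto intro!: basic_semialgebraic_imp_semialgebraic basic_semialgebraic_Int)
  also have "(\<Union>(A, A')\<in>F \<times> G. A \<inter> A') = S \<inter> T"
    using F G by auto
  finally show ?thesis .
qed

lemma semialgebraic_INT: "finite I \<Longrightarrow> (\<And>i. i \<in> I \<Longrightarrow> semialgebraic (S i)) \<Longrightarrow> semialgebraic (\<Inter>i\<in>I. S i)"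
  by (induction rule: finite_induct) (auto intro: semialgebraic_UNIV semialgebraic_Int)

lemma basic_semialgebraic_Compl:
  assumes "basic_semialgebraic S"
  shows "semialgebraic (- S)"
proof -
  obtain P Q where S: "finite P" "finite Q" "\<And>p. p \<in> P \<Longrightarrow> real_polynomial_function p"
    "\<And>q. q \<in> Q \<Longrightarrow> real_polynomial_function q" "S = {x. (\<forall>p\<in>P. p x = 0) \<and> (\<forall>q\<in>Q. q x > 0)}"
    using assms unfolding basic_semialgebraic_def by blast
  have "- S = (\<Union>p\<in>P. {x. 0 < p x} \<union> {x. 0 < - p x}) \<union> (\<Union>q\<in>Q. {x. q x = 0} \<union> {x. 0 < - q x})"
    unfolding S(5) by (auto simp: not_less order.order_iff_strict)
  also have "semialgebraic \<dots>"
    by (intro semialgebraic_Un semialgebraic_UN S(1,2) semialgebraic_zero_set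
        semialgebraic_positive_set real_polynomial_function_minus S(3,4))
  finally show ?thesis .
qed

lemma semialgebraic_Compl:
  assumes "semialgebraic S"
  shows "semialgebraic (- S)"
proof -
  obtain F where F: "finite F" "\<And>A. A \<in> F \<Longrightarrow> basic_semialgebraic A" "S = \<Union>F"
    using assms unfolding semialgebraic_def by blast
  have "semialgebraic (\<Inter>A\<in>F. - A)"
    by (intro semialgebraic_INT F(1) basic_semialgebraic_Compl F(2))
  then show ?thesis
    by (simp add: F(3) flip: Compl_UN)
qed

lemma algebra_semialgebraic: "algebra UNIV (Collect semialgebraic)"
  by (simp add: algebra_iff_Un semialgebraic_empty semialgebraic_Un semialgebraic_Compl
      flip: Compl_eq_Diff_UNIV)

lemma semialgebraic_vimage:
  fixes h :: "'a::euclidean_space \<Rightarrow> 'b::euclidean_space"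
  assumes h: "polynomial_function h" and S: "semialgebraic S"
  shows "semialgebraic (h -` S)"
proof -
  have "basic_semialgebraic (h -` A)" if basic: "basic_semialgebraic A" for A
  proof -
    obtain P Q where A: "finite P" "finite Q" "\<forall>p\<in>P. real_polynomial_function p"
      "\<forall>q\<in>Q. real_polynomial_function q" "A = {x. (\<forall>p\<in>P. p x = 0) \<and> (\<forall>q\<in>Q. q x > 0)}"
      using basic unfolding basic_semialgebraic_def by blast
    have "h -` A = {x. (\<forall>p\<in>(\<lambda>p. p \<circ> h) ` P. p x = 0) \<and> (\<forall>q\<in>(\<lambda>q. q \<circ> h) ` Q. q x > 0)}"
      by (simp add: A(5))
    moreover have "real_polynomial_function (p \<circ> h)" if "p \<in> P \<union> Q" for p
      using A(3,4) that by (intro real_polynomial_function_compose[OF h]) blast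
    ultimately show ?thesis
      unfolding basic_semialgebraic_def
      by - (rule exI[of _ "(\<lambda>p. p \<circ> h) ` P"], rule exI[of _ "(\<lambda>q. q \<circ> h) ` Q"],
          simp add: A(1,2))
  qed
  moreover obtain F where F: "finite F" "\<And>A. A \<in> F \<Longrightarrow> basic_semialgebraic A" "S = \<Union>F"
    using S unfolding semialgebraic_def by blast
  ultimately have "semialgebraic (\<Union>A\<in>F. h -` A)"
    by (intro semialgebraic_UN basic_semialgebraic_imp_semialgebraic) auto
  then show ?thesis
    by (simp add: F(3) vimage_Union)
qed

lemma semialgebraic_vimage_linear:
  "bounded_linear h \<Longrightarrow> semialgebraic S \<Longrightarrow> semialgebraic (h -` S)"
  by (intro semialgebraic_vimage polynomial_function_bounded_linear)

section \<open>Projections of semialgebraic sets\<close>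

lemma function_ring_real_polynomials: "function_ring (Collect real_polynomial_function)"
  by standard auto

text \<open>
  The restriction of a polynomial function to the lines in direction \<open>v\<close> is a polynomial in the line
  parameter over the ring of polynomial functions of the base point.
\<close>
lemma real_polynomial_function_on_line:
  fixes p :: "'a::euclidean_space \<Rightarrow> real" and v :: 'a
  assumes "real_polynomial_function p"
  shows "\<exists>q n. poly_over (Collect real_polynomial_function) n q \<and> (\<forall>x t. p (x + t *\<^sub>R v) = poly (q x) t)"
proof -
  interpret function_ring "Collect real_polynomial_function :: ('a \<Rightarrow> real) set"
    by (rule function_ring_real_polynomials)
  let ?R = "Collect real_polynomial_function :: ('a \<Rightarrow> real) set"
  show ?thesis
    using assms
  proof induction
    case (linear f)
    then have mem: "f \<in> ?R" "(\<lambda>x. f v) \<in> ?R"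
      by auto
    interpret bounded_linear f by fact
    let ?q = "\<lambda>x. monom (f x) 0 + monom (f v) 1"
    have "poly_over ?R 1 ?q"
      using mem by (intro poly_over_add poly_over_monom poly_over_le[OF poly_over_monom]) auto
    moreover have "f (x + t *\<^sub>R v) = poly (?q x) t" for x t
      by (simp add: add scaleR poly_monom)
    ultimately show ?case
      by blast
  next
    case (const c)
    have "poly_over ?R 0 (\<lambda>x. monom c 0)"
      by (intro poly_over_monom function_ring.const[OF function_ring_real_polynomials])
    moreover have "c = poly (monom c 0) t" for t
      by (simp add: poly_monom)
    ultimately show ?case
      by blast
  next
    case (add f g)
    then obtain q n r m where q: "poly_over ?R n q" "\<And>x t. f (x + t *\<^sub>R v) = poly (q x) t"
      and r: "poly_over ?R m r" "\<And>x t. g (x + t *\<^sub>R v) = poly (r x) t"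
      by blast
    have "poly_over ?R (max n m) (\<lambda>x. q x + r x)"
      by (intro poly_over_add poly_over_le[OF q(1)] poly_over_le[OF r(1)]) auto
    moreover have "f (x + t *\<^sub>R v) + g (x + t *\<^sub>R v) = poly (q x + r x) t" for x t
      by (simp add: q r)
    ultimately show ?case
      by blast
  next
    case (mult f g)
    then obtain q n r m where q: "poly_over ?R n q" "\<And>x t. f (x + t *\<^sub>R v) = poly (q x) t"
      and r: "poly_over ?R m r" "\<And>x t. g (x + t *\<^sub>R v) = poly (r x) t"
      by blast
    have "f (x + t *\<^sub>R v) * g (x + t *\<^sub>R v) = poly (q x * r x) t" for x t
      by (simp add: q r)
    with poly_over_mult[OF q(1) r(1)] show ?case
      by blast
  qed
qed

text \<open>
  Projecting along \<open>v\<close> is rendered as taking the union of all lines in direction \<open>v\<close> that meet \<open>S\<close>.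
  This keeps the ambient space fixed, so that the elimination can be iterated over a basis within one
  type.
\<close>
lemma basic_semialgebraic_saturate_line:
  fixes v :: "'a::euclidean_space"
  assumes "basic_semialgebraic S"
  shows "semialgebraic {x. \<exists>t. x + t *\<^sub>R v \<in> S}"
proof -
  let ?R = "Collect real_polynomial_function :: ('a \<Rightarrow> real) set"
  obtain P Q where S: "finite P" "finite Q" "\<forall>p\<in>P. real_polynomial_function p"
    "\<forall>q\<in>Q. real_polynomial_function q" "S = {x. (\<forall>p\<in>P. p x = 0) \<and> (\<forall>q\<in>Q. q x > 0)}"
    using assms unfolding basic_semialgebraic_def by blast
  have "\<forall>p\<in>P \<union> Q. \<exists>q. (\<exists>n. poly_over ?R n q) \<and> (\<forall>x t. p (x + t *\<^sub>R v) = poly (q x) t)"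
    using S(3,4) real_polynomial_function_on_line by blast
  then obtain r where "\<forall>p\<in>P \<union> Q. (\<exists>n. poly_over ?R n (r p)) \<and> (\<forall>x t. p (x + t *\<^sub>R v) = poly (r p x) t)"
    by (rule bchoice[THEN exE])
  then have r: "\<And>p. p \<in> P \<union> Q \<Longrightarrow> \<exists>n. poly_over ?R n (r p)"
    and eq: "\<And>p x t. p \<in> P \<union> Q \<Longrightarrow> p (x + t *\<^sub>R v) = poly (r p x) t"
    by blast+
  have "{x. \<exists>t. (\<forall>p\<in>r ` P. poly (p x) t = 0) \<and> (\<forall>q\<in>r ` Q. 0 < poly (q x) t)} \<in> Collect semialgebraic"
    using S(1,2) r
    by (intro function_ring.projection_in_algebra[OF function_ring_real_polynomials] algebra_semialgebraic)
      (auto intro: semialgebraic_positive_set)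
  moreover have "x + t *\<^sub>R v \<in> S \<longleftrightarrow>
      (\<forall>p\<in>r ` P. poly (p x) t = 0) \<and> (\<forall>q\<in>r ` Q. 0 < poly (q x) t)" for x t
    using eq by (simp add: S(5))
  ultimately show ?thesis
    by simp
qed

lemma semialgebraic_saturate_line:
  fixes v :: "'a::euclidean_space"
  assumes "semialgebraic S"
  shows "semialgebraic {x. \<exists>t. x + t *\<^sub>R v \<in> S}"
proof -
  obtain F where F: "finite F" "\<And>A. A \<in> F \<Longrightarrow> basic_semialgebraic A" "S = \<Union>F"
    using assms unfolding semialgebraic_def by blast
  have "semialgebraic (\<Union>A\<in>F. {x. \<exists>t. x + t *\<^sub>R v \<in> A})"
    by (intro semialgebraic_UN F(1) basic_semialgebraic_saturate_line F(2))
  also have "(\<Union>A\<in>F. {x. \<exists>t. x + t *\<^sub>R v \<in> A}) = {x. \<exists>t. x + t *\<^sub>R v \<in> S}"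
    by (auto simp: F(3))
  finally show ?thesis .
qed

lemma semialgebraic_saturate_span:
  fixes S :: "'a::euclidean_space set"
  assumes "finite V" and "semialgebraic S"
  shows "semialgebraic {x. \<exists>w\<in>span V. x + w \<in> S}"
  using assms
proof (induction V arbitrary: S)
  case empty
  then show ?case
    by simp
next
  case (insert v V)
  have "{x. \<exists>w\<in>span (insert v V). x + w \<in> S} = {x. \<exists>t. x + t *\<^sub>R v \<in> {y. \<exists>w\<in>span V. y + w \<in> S}}"
  proof (intro set_eqI iffI; clarsimp)
    fix x w assume w: "w \<in> span (insert v V)" "x + w \<in> S"
    then obtain t where "w - t *\<^sub>R v \<in> span V"
      by (auto simp: span_breakdown_eq)
    with w(2) show "\<exists>t. \<exists>w\<in>span V. x + t *\<^sub>R v + w \<in> S"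
      by (intro exI[of _ t] bexI[of _ "w - t *\<^sub>R v"]) auto
  next
    fix x t w assume w: "w \<in> span V" "x + t *\<^sub>R v + w \<in> S"
    then have "t *\<^sub>R v + w \<in> span (insert v V)"
      by (auto simp: span_breakdown_eq intro!: exI[of _ t])
    with w(2) show "\<exists>w\<in>span (insert v V). x + w \<in> S"
      by (auto simp: add.assoc)
  qed
  then show ?case
    using semialgebraic_saturate_line[OF insert.IH[OF insert.prems]] by simp
qed

text \<open>
  The Tarski-Seidenberg theorem: saturate \<open>S\<close> in all directions of the second factor and then intersect
  with the copy of the first factor at zero.
\<close>
theorem semialgebraic_projection:
  fixes S :: "('a::euclidean_space \<times> 'b::euclidean_space) set"
  assumes "semialgebraic S"
  shows "semialgebraic (fst ` S)"
proof -
  let ?V = "Pair (0::'a) ` (Basis :: 'b set)"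
  have "linear (Pair (0::'a) :: 'b \<Rightarrow> 'a \<times> 'b)"
    by (intro linearI) auto
  then have span: "span ?V = range (Pair 0)"
    by (simp add: span_linear_image span_Basis)
  have "semialgebraic ((\<lambda>x. (x, 0)) -` {z. \<exists>w\<in>span ?V. z + w \<in> S})"
    using assms
    by (intro semialgebraic_vimage_linear semialgebraic_saturate_span)
      (auto intro: bounded_linear_intros bounded_linear_Pair bounded_linear_ident bounded_linear_zero)
  also have "(\<lambda>x. (x, 0)) -` {z. \<exists>w\<in>span ?V. z + w \<in> S} = fst ` S"
    unfolding span by force
  finally show ?thesis .
qed

section \<open>The distance function\<close>

lemma is_norm_continuous:
  fixes \<nu> :: "'a::euclidean_space \<Rightarrow> real"
  assumes "is_norm \<nu>"
  shows "continuous_on UNIV \<nu>"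
proof -
  have "convex_on UNIV \<nu>"
  proof (rule convex_onI)
    fix t :: real and x y :: 'a
    assume t: "0 < t" "t < 1"
    have "\<nu> ((1 - t) *\<^sub>R x + t *\<^sub>R y) \<le> \<nu> ((1 - t) *\<^sub>R x) + \<nu> (t *\<^sub>R y)"
      using assms unfolding is_norm_def by blast
    also have "\<dots> = (1 - t) * \<nu> x + t * \<nu> y"
      using assms t by (simp add: is_norm_def)
    finally show "\<nu> ((1 - t) *\<^sub>R x + t *\<^sub>R y) \<le> (1 - t) * \<nu> x + t * \<nu> y" .
  qed simp
  then show ?thesis
    by (intro convex_on_continuous) auto
qed

text \<open>The constant is the minimum of \<open>\<nu>\<close> on the unit sphere.\<close>
lemma is_norm_lower_bound:
  fixes \<nu> :: "'a::euclidean_space \<Rightarrow> real"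
  assumes "is_norm \<nu>"
  obtains m where "0 < m" and "\<And>x. m * norm x \<le> \<nu> x"
proof -
  have "continuous_on (sphere 0 1) \<nu>"
    using is_norm_continuous[OF assms] by (rule continuous_on_subset) simp
  then obtain z where z: "z \<in> sphere 0 1" "\<forall>y\<in>sphere 0 1. \<nu> z \<le> \<nu> y"
    using continuous_attains_inf[OF compact_sphere, of 0 1 \<nu>] by auto
  have "z \<noteq> 0"
    using z(1) by auto
  then have "\<nu> z \<noteq> 0" and "0 \<le> \<nu> z"
    using assms by (simp_all add: is_norm_def)
  then have "0 < \<nu> z"
    by simp
  moreover have "\<nu> z * norm x \<le> \<nu> x" for x
  proof (cases "x = 0")
    case False
    have "\<nu> x = norm x * \<nu> (x /\<^sub>R norm x)"
      using assms False unfolding is_norm_def by (simp add: field_simps)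
    moreover have "\<nu> z \<le> \<nu> (x /\<^sub>R norm x)"
      using False by (intro z(2)[rule_format]) simp
    ultimately show ?thesis
      using False by (simp add: mult.commute)
  qed (use assms in \<open>simp add: is_norm_def\<close>)
  ultimately show thesis
    using that by blast
qed

lemma is_norm_distance_attained:
  fixes C :: "'a::euclidean_space set" and x :: 'a
  assumes "C \<noteq> {}" "closed C" and \<nu>: "is_norm \<nu>"
  obtains y where "y \<in> C" and "\<And>z. z \<in> C \<Longrightarrow> \<nu> (x - y) \<le> \<nu> (x - z)"
proof -
  obtain m where m: "0 < m" "\<And>x. m * norm x \<le> \<nu> x"
    using is_norm_lower_bound[OF \<nu>] by blast
  obtain c where "c \<in> C"
    using assms(1) by blast
  \<comment> \<open>Points of \<open>C\<close> that are at least as close to \<open>x\<close> as \<open>c\<close> is lie in a ball, by the lower bound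
    on \<open>\<nu>\<close>; so the minimum over the compact set \<open>?K\<close> is the minimum over \<open>C\<close>.\<close>
  let ?K = "C \<inter> cball x (\<nu> (x - c) / m)"
  have near: "z \<in> ?K" if "z \<in> C" "\<nu> (x - z) \<le> \<nu> (x - c)" for z
    using m(2)[of "x - z"] m(1) that by (auto simp: dist_norm field_simps)
  have "compact ?K"
    using assms(2) by (intro closed_Int_compact) auto
  moreover have "?K \<noteq> {}"
    using near[of c] \<open>c \<in> C\<close> by auto
  moreover have "continuous_on ?K (\<lambda>y. \<nu> (x - y))"
    by (intro continuous_on_compose2[OF is_norm_continuous[OF \<nu>]] continuous_intros) auto
  ultimately obtain y where y: "y \<in> ?K" "\<And>z. z \<in> ?K \<Longrightarrow> \<nu> (x - y) \<le> \<nu> (x - z)"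
    using continuous_attains_inf by metis
  have "\<nu> (x - y) \<le> \<nu> (x - z)" if "z \<in> C" for z
    using y(2)[OF near[of z]] y(2)[OF near[of c]] that \<open>c \<in> C\<close>
    by (cases "\<nu> (x - z) \<le> \<nu> (x - c)") auto
  with y(1) show thesis
    using that by blast
qed

text \<open>
  The graph of the distance function in terms of existential quantifiers over \<open>C\<close> only, which is the form that
  the projection theorem handles.
\<close>
lemma dist_norm_set_eq_iff:
  fixes C :: "'a::euclidean_space set"
  assumes "C \<noteq> {}" "closed C" "is_norm \<nu>"
  shows "dist_norm_set \<nu> x C = r \<longleftrightarrow> (\<exists>y\<in>C. \<nu> (x - y) = r) \<and> \<not> (\<exists>y\<in>C. \<nu> (x - y) < r)"
proof -
  obtain y where y: "y \<in> C" "\<And>z. z \<in> C \<Longrightarrow> \<nu> (x - y) \<le> \<nu> (x - z)"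
    using is_norm_distance_attained[OF assms] by blast
  then have "dist_norm_set \<nu> x C = \<nu> (x - y)"
    unfolding dist_norm_set_def by (intro Least_equality) auto
  then show ?thesis
    using y by (metis leD order_le_less)
qed

theorem semialgebraic_fun_dist_norm_set:
  fixes C :: "'a::euclidean_space set" and \<nu> :: "'a \<Rightarrow> real"
  assumes "C \<noteq> {}" and "closed C" and "semialgebraic C"
    and "is_norm \<nu>" and "semialgebraic_fun \<nu>"
  shows "semialgebraic_fun (\<lambda>x. dist_norm_set \<nu> x C)"
proof -
  let ?G = "{(x, \<nu> x) |x. x \<in> UNIV}"
  have G: "semialgebraic ?G"
    using assms(5) by (simp add: semialgebraic_fun_def)
  note lin = bounded_linear_intros bounded_linear_Pair bounded_linear_ident bounded_linear_sub
    bounded_linear_fst_comp bounded_linear_snd_comp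
  have fst_image: "fst ` T = {z. \<exists>w. (z, w) \<in> T}" for T :: "('b \<times> 'c) set"
    by force
  let ?E = "{(x, r). \<exists>y\<in>C. \<nu> (x - y) = r}"
  let ?L = "{(x, r). \<exists>y\<in>C. \<nu> (x - y) < r}"
  \<comment> \<open>Triples \<open>((x, r), y)\<close> with \<open>y \<in> C\<close> and \<open>r = \<nu> (x - y)\<close>.\<close>
  have "semialgebraic (fst ` ((snd -` C) \<inter> (\<lambda>z. (fst (fst z) - snd z, snd (fst z))) -` ?G))"
    by (intro semialgebraic_projection semialgebraic_Int semialgebraic_vimage_linear assms(3) G lin)
  also have "fst ` ((snd -` C) \<inter> (\<lambda>z. (fst (fst z) - snd z, snd (fst z))) -` ?G) = ?E"
    unfolding fst_image by auto
  finally have E: "semialgebraic ?E" .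
  \<comment> \<open>Quadruples \<open>((x, r), (y, s))\<close> with \<open>y \<in> C\<close> and \<open>\<nu> (x - y) = s < r\<close>: the inequality needs the value
    of \<open>\<nu>\<close> as a variable of its own, because only the graph of \<open>\<nu>\<close> is known to be semialgebraic.\<close>
  have "semialgebraic (fst ` (((\<lambda>z. fst (snd z)) -` C) \<inter>
      (\<lambda>z. (fst (fst z) - fst (snd z), snd (snd z))) -` ?G \<inter> {z. 0 < snd (fst z) - snd (snd z)}))"
    by (intro semialgebraic_projection semialgebraic_Int semialgebraic_vimage_linear
        semialgebraic_positive_set real_polynomial_function.intros(1) assms(3) G lin)
  also have "fst ` (((\<lambda>z. fst (snd z)) -` C) \<inter>
      (\<lambda>z. (fst (fst z) - fst (snd z), snd (snd z))) -` ?G \<inter> {z. 0 < snd (fst z) - snd (snd z)}) = ?L"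
    unfolding fst_image by auto
  finally have "semialgebraic (?E \<inter> - ?L)"
    by (intro semialgebraic_Int E semialgebraic_Compl)
  also have "?E \<inter> - ?L = {(x, r). dist_norm_set \<nu> x C = r}"
    unfolding dist_norm_set_eq_iff[OF assms(1,2,4)] by auto
  also have "\<dots> = {(x, dist_norm_set \<nu> x C) |x. x \<in> UNIV}"
    by auto
  finally show ?thesis
    by (simp add: semialgebraic_fun_def)
qed

theorem lemma3p1:
  fixes C :: "(real ^ 'n) set" and \<nu> :: "real ^ 'n \<Rightarrow> real"
  assumes "C \<noteq> {}" and "closed C" and "semialgebraic C"
    and "is_norm \<nu>" and "semialgebraic_fun \<nu>"
  shows "semialgebraic_fun (\<lambda>x. dist_norm_set \<nu> x C)"
  using assms by (rule semialgebraic_fun_dist_norm_set)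

end
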